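(* Let $\|\cdot\|_c$ and $\|\cdot\|_s$ be norms on $\mathbb{R}^d$, and suppose that $g(x):=\frac12\|x\|_s^2$ is $L$-smooth with respect to $\|\cdot\|_s$ for some $L>0$. Let $f(x)=\frac12\|x\|_c^2$, let $\theta>0$, and define $$M_f^{\theta,g}(x)=\min_{u\in\mathbb{R}^d}\Big\{f(u)+\frac1\theta g(x-u)\Big\},\qquad x\in\mathbb{R}^d.$$ Then: (1) There exists a norm $\|\cdot\|_m$ on $\mathbb{R}^d$ such that $M_f^{\theta,g}(x)=\frac12\|x\|_m^2$ for all $x\in\mathbb{R}^d$. (2) Let $\ell_{cs}\in(0,1]$ and $u_{cs}\in[1,\infty)$ be such that $\ell_{cs}\|x\|_s\le\|x\|_c\le u_{cs}\|x\|_s$ for all $x\in\mathbb{R}^d$. Then $\ell_{cm}\|x\|_m\le\|x\|_c\le u_{cm}\|x\|_m$ for all $x\in\mathbb{R}^d$, where $\ell_{cm}=(1+\theta\ell_{cs}^2)^{1/2}$ and $u_{cm}=(1+\theta u_{cs}^2)^{1/2}$. (3) $M_f^{\theta,g}$ is convex and $\frac{L}{\theta}$-smooth with respect to $\|\cdot\|_s$.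
   Context: A convex differentiable function $h:\mathbb{R}^d\to\mathbb{R}$ is called $L$-smooth with respect to a norm $\|\cdot\|$ if $h(y)\le h(x)+\langle\nabla h(x),y-x\rangle+\frac{L}{2}\|x-y\|^2$ for all $x,y\in\mathbb{R}^d$, where $\langle\cdot,\cdot\rangle$ is the standard inner product. The function $M_f^{\theta,g}$ is called the generalized Moreau envelope of $f$ with respect to $g$. *)

theory Defs
  imports "HOL-Analysis.Analysis"
begin

(* The type class "real_normed_vector" fixes one norm per type. Several norms on the same space
   are needed here, so a norm is a function satisfying the norm axioms. *)
definition is_norm :: "('a::real_vector \<Rightarrow> real) \<Rightarrow> bool" where
  "is_norm N \<longleftrightarrow>
     (\<forall>x. 0 \<le> N x) \<and>
     (\<forall>x. N x = 0 \<longleftrightarrow> x = 0) \<and>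
     (\<forall>a x. N (a *\<^sub>R x) = \<bar>a\<bar> * N x) \<and>
     (\<forall>x y. N (x + y) \<le> N x + N y)"

(* Convexity and differentiability are part of the notion. The gradient G is taken with respect to
   the standard inner product, independently of N. *)
definition smooth_wrt :: "real \<Rightarrow> ('a::real_inner \<Rightarrow> real) \<Rightarrow> ('a \<Rightarrow> real) \<Rightarrow> bool" where
  "smooth_wrt L N h \<longleftrightarrow>
     convex_on UNIV h \<and>
     (\<exists>G. (\<forall>x. GDERIV h x :> G x) \<and>
          (\<forall>x y. h y \<le> h x + G x \<bullet> (y - x) + L / 2 * (N (x - y))\<^sup>2))"

definition moreau_objective ::
    "real \<Rightarrow> ('a::real_vector \<Rightarrow> real) \<Rightarrow> ('a \<Rightarrow> real) \<Rightarrow> 'a \<Rightarrow> 'a \<Rightarrow> real" where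
  "moreau_objective \<theta> f g x u = f u + 1 / \<theta> * g (x - u)"

(* The least value of the objective, i.e. its minimum over u. The operator LEAST is meaningful
   only where the minimum is attained. *)
definition moreau_envelope ::
    "real \<Rightarrow> ('a::real_vector \<Rightarrow> real) \<Rightarrow> ('a \<Rightarrow> real) \<Rightarrow> 'a \<Rightarrow> real" where
  "moreau_envelope \<theta> f g x = (LEAST v. v \<in> range (moreau_objective \<theta> f g x))"

end

theory Submission
  imports Defs
begin

text \<open>
  The root of \<open>2 M(x)\<close> is the minimum over \<open>u\<close> of the Euclidean length of the plane vector
  \<open>(norm_c u, norm_s (x - u) / sqrt \<theta>)\<close>, so Minkowski's inequality in the plane makes it a norm.
  Its lower comparison with \<open>norm_c\<close> tests the minimum at multiples of \<open>x\<close>; the upper one is the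
  Cauchy--Schwarz inequality.  Freezing the minimiser \<open>u\<close> of \<open>x\<close> gives the quadratic upper bound
  for \<open>M\<close> with gradient \<open>\<nabla>g(x - u) / \<theta>\<close>; reflecting it at \<open>x\<close>, convexity turns it into a
  quadratic lower bound, so \<open>M\<close> is differentiable with that gradient.
\<close>

lemma is_normD:
  assumes "is_norm N"
  shows "0 \<le> N x" "N x = 0 \<longleftrightarrow> x = 0" "N (a *\<^sub>R x) = \<bar>a\<bar> * N x" "N (x + y) \<le> N x + N y"
  using assms unfolding is_norm_def by blast+

lemma is_norm_minus_commute: "is_norm N \<Longrightarrow> N (x - y) = N (y - x)"
  using is_normD(3)[of N "-1" "y - x"] by simp

lemma is_norm_convex_on:
  assumes N: "is_norm N"
  shows "convex_on UNIV N"
proof (rule convex_onI)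
  fix t :: real and x y
  assume "0 < t" "t < 1"
  then show "N ((1 - t) *\<^sub>R x + t *\<^sub>R y) \<le> (1 - t) * N x + t * N y"
    using is_normD(4)[OF N, of "(1 - t) *\<^sub>R x" "t *\<^sub>R y"] by (simp add: is_normD(3)[OF N])
qed simp

text \<open>Squaring is increasing on nonnegative reals, so convexity passes from \<open>N\<close>
  to the real square, whose convexity defect is exactly
  \<open>t * (1 - t) * (N x - N y)\<^sup>2\<close>.\<close>

lemma is_norm_half_square_convex_on:
  assumes N: "is_norm N"
  shows "convex_on UNIV (\<lambda>x. 1 / 2 * (N x)\<^sup>2)"
proof (rule convex_onI)
  fix t :: real and x y
  assume t: "0 < t" "t < 1"
  have "(N ((1 - t) *\<^sub>R x + t *\<^sub>R y))\<^sup>2 \<le> ((1 - t) * N x + t * N y)\<^sup>2"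
    using convex_onD[OF is_norm_convex_on[OF N], of t x y] t
    by (intro power_mono) (auto simp: is_normD(1)[OF N])
  also have "\<dots> = (1 - t) * (N x)\<^sup>2 + t * (N y)\<^sup>2 - t * (1 - t) * (N x - N y)\<^sup>2"
    by (simp add: power2_eq_square algebra_simps)
  also have "\<dots> \<le> (1 - t) * (N x)\<^sup>2 + t * (N y)\<^sup>2"
    using t by simp
  finally show "1 / 2 * (N ((1 - t) *\<^sub>R x + t *\<^sub>R y))\<^sup>2
      \<le> (1 - t) * (1 / 2 * (N x)\<^sup>2) + t * (1 / 2 * (N y)\<^sup>2)"
    by simp
qed simp

text \<open>A convex function on a finite-dimensional space is continuous. This makes continuity
  available before the comparison with \<open>norm\<close>, whose proof relies on it.\<close>

lemma is_norm_continuous_on: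
  fixes N :: "'a::euclidean_space \<Rightarrow> real"
  assumes "is_norm N"
  shows "continuous_on S N"
  using convex_on_continuous[OF open_UNIV is_norm_convex_on[OF assms]] continuous_on_subset by blast

text \<open>The constants are the extreme values of \<open>N\<close> on the compact Euclidean unit
  sphere; homogeneity carries them to all vectors. The lower one will give coercivity, the upper one
  will turn bounds in \<open>N\<close> into Euclidean bounds for derivatives.\<close>

lemma is_norm_equivalent:
  fixes N :: "'a::euclidean_space \<Rightarrow> real"
  assumes N: "is_norm N"
  obtains k K where "0 < k" "0 < K" "\<And>x. k * norm x \<le> N x" "\<And>x. N x \<le> K * norm x"
proof -
  have sph: "sphere (0::'a) 1 \<noteq> {}"
    using norm_Basis[OF SOME_Basis] by (metis mem_sphere_0 empty_iff)
  obtain a where a: "a \<in> sphere 0 1" "\<And>y. y \<in> sphere 0 1 \<Longrightarrow> N a \<le> N y"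
    using continuous_attains_inf[OF compact_sphere sph is_norm_continuous_on[OF N]] by blast
  obtain b where b: "b \<in> sphere 0 1" "\<And>y. y \<in> sphere 0 1 \<Longrightarrow> N y \<le> N b"
    using continuous_attains_sup[OF compact_sphere sph is_norm_continuous_on[OF N]] by blast
  have pos: "0 < N z" if "z \<in> sphere 0 1" for z
    using is_normD(1,2)[OF N, of z] that by (auto simp: less_le)
  have "N a * norm x \<le> N x \<and> N x \<le> N b * norm x" for x
  proof (cases "x = 0")
    case True
    then show ?thesis using is_normD(2)[OF N, of x] by simp
  next
    case False
    have "x /\<^sub>R norm x \<in> sphere 0 1" using False by simp
    then have "N a \<le> N (x /\<^sub>R norm x)" "N (x /\<^sub>R norm x) \<le> N b" using a b by blast+
    moreover have "N (x /\<^sub>R norm x) = N x / norm x"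
      by (simp add: is_normD(3)[OF N] divide_inverse mult.commute)
    ultimately show ?thesis
      using False by (simp add: pos_le_divide_eq pos_divide_le_eq)
  qed
  with that pos[OF a(1)] pos[OF b(1)] show ?thesis by blast
qed

lemma GDERIV_of_quadratic_bound:
  fixes h :: "'a::real_inner \<Rightarrow> real"
  assumes bound: "\<And>y. \<bar>h y - h x - G \<bullet> (y - x)\<bar> \<le> C * (norm (y - x))\<^sup>2"
  shows "GDERIV h x :> G"
  unfolding gderiv_def has_derivative_at_alt
proof (intro conjI allI impI)
  show "bounded_linear (\<lambda>z. z \<bullet> G)" by (rule bounded_linear_inner_left)
  fix e :: real assume e: "0 < e"
  \<comment> \<open>The denominator \<open>\<bar>C\<bar> + 1\<close> is positive and dominates
    \<open>C\<close>, whatever the sign of \<open>C\<close>.\<close>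
  define d where "d = e / (\<bar>C\<bar> + 1)"
  have d: "0 < d" using e by (simp add: d_def)
  have "norm (h y - h x - (y - x) \<bullet> G) \<le> e * norm (y - x)" if y: "norm (y - x) < d" for y
  proof -
    have "\<bar>h y - h x - G \<bullet> (y - x)\<bar> \<le> C * (norm (y - x))\<^sup>2" by (rule bound)
    also have "\<dots> \<le> (\<bar>C\<bar> + 1) * norm (y - x) * norm (y - x)"
      by (simp add: power2_eq_square mult.assoc mult_right_mono)
    also have "\<dots> \<le> e * norm (y - x)"
      using y by (intro mult_right_mono) (auto simp: d_def field_simps)
    finally show ?thesis by (simp add: inner_commute)
  qed
  with d show "\<exists>d>0. \<forall>y. norm (y - x) < d \<longrightarrow>
      norm (h y - h x - (y - x) \<bullet> G) \<le> e * norm (y - x)" by blast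
qed

text \<open>Here \<open>G\<close> is only a candidate gradient with a one-sided bound; convexity
  supplies the other side, and the two together force differentiability.\<close>

lemma convex_smooth_wrtI:
  fixes h :: "'a::euclidean_space \<Rightarrow> real"
  assumes h: "convex_on UNIV h" and N: "is_norm N" and "0 \<le> L"
    and bound: "\<And>x y. h y \<le> h x + G x \<bullet> (y - x) + L / 2 * (N (x - y))\<^sup>2"
  shows "smooth_wrt L N h"
proof -
  obtain K where K: "0 < K" "\<And>x. N x \<le> K * norm x"
    using is_norm_equivalent[OF N] by metis
  have "GDERIV h x :> G x" for x
  proof (rule GDERIV_of_quadratic_bound)
    fix y
    have up: "h y \<le> h x + G x \<bullet> (y - x) + L / 2 * (N (y - x))\<^sup>2"
      using bound[of y x] by (simp add: is_norm_minus_commute[OF N, of x y])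
    \<comment> \<open>The point \<open>2 *\<^sub>R x - y\<close> is the mirror image of
      \<open>y\<close> in \<open>x\<close>: the linear term changes sign, the quadratic one does
      not.\<close>
    have reflected: "h (2 *\<^sub>R x - y) \<le> h x - G x \<bullet> (y - x) + L / 2 * (N (y - x))\<^sup>2"
      using bound[of "2 *\<^sub>R x - y" x] by (simp add: algebra_simps scaleR_2)
    have mid: "(1/2) *\<^sub>R (2 *\<^sub>R x - y) + (1/2) *\<^sub>R y = x" by (simp add: algebra_simps)
    have "2 * h x \<le> h y + h (2 *\<^sub>R x - y)"
      using convex_onD[OF h, of "1/2" "2 *\<^sub>R x - y" y] by (simp add: mid)
    with up reflected have "\<bar>h y - h x - G x \<bullet> (y - x)\<bar> \<le> L / 2 * (N (y - x))\<^sup>2" by linarith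
    also have "\<dots> \<le> L / 2 * (K * norm (y - x))\<^sup>2"
      using K(2)[of "y - x"] \<open>0 \<le> L\<close> by (intro mult_left_mono power_mono) (auto simp: is_normD(1)[OF N])
    finally show "\<bar>h y - h x - G x \<bullet> (y - x)\<bar> \<le> (L / 2 * K\<^sup>2) * (norm (y - x))\<^sup>2"
      by (simp add: power_mult_distrib mult.assoc)
  qed
  with h bound show ?thesis unfolding smooth_wrt_def by blast
qed

text \<open>At \<open>u = x\<close> the second term vanishes, leaving half of
  \<open>(N x)\<^sup>2\<close>. Outside a large ball the first term alone is at least that much, so
  a minimiser over the compact ball is a global one.\<close>

lemma moreau_objective_attains_min:
  fixes N N' :: "'a::euclidean_space \<Rightarrow> real"
  assumes N: "is_norm N" and N': "is_norm N'" and "\<theta> > 0"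
  shows "\<exists>u. \<forall>v. moreau_objective \<theta> (\<lambda>x. 1 / 2 * (N x)\<^sup>2) (\<lambda>x. 1 / 2 * (N' x)\<^sup>2) x u
           \<le> moreau_objective \<theta> (\<lambda>x. 1 / 2 * (N x)\<^sup>2) (\<lambda>x. 1 / 2 * (N' x)\<^sup>2) x v"
    (is "\<exists>u. \<forall>v. ?J u \<le> ?J v")
proof -
  obtain k where k: "0 < k" "\<And>x. k * norm x \<le> N x"
    using is_norm_equivalent[OF N] by metis
  let ?B = "cball (0::'a) (N x / k)"
  have x: "x \<in> ?B" using k(1) k(2)[of x] by (simp add: field_simps)
  have "continuous_on ?B ?J"
    unfolding moreau_objective_def
    by (intro continuous_intros is_norm_continuous_on[OF N]
        continuous_on_compose2[OF is_norm_continuous_on[OF N', of UNIV]]) auto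
  then obtain u where u: "u \<in> ?B" "\<And>v. v \<in> ?B \<Longrightarrow> ?J u \<le> ?J v"
    using continuous_attains_inf[OF compact_cball] x by (metis empty_iff)
  have "?J u \<le> ?J v" for v
  proof (cases "v \<in> ?B")
    case False
    then have "N x \<le> N v" using k(1) k(2)[of v] by (simp add: field_simps)
    then have "(N x)\<^sup>2 \<le> (N v)\<^sup>2" by (intro power_mono) (auto simp: is_normD(1)[OF N])
    moreover have "N' 0 = 0" using is_normD(2)[OF N'] by simp
    ultimately have "?J x \<le> ?J v" using \<open>\<theta> > 0\<close> by (simp add: moreau_objective_def add_increasing2)
    with u(2)[OF x] show ?thesis by simp
  qed (use u in blast)
  then show ?thesis by blast
qed

text \<open>The reals are not well-ordered, so \<open>LEAST\<close> is evaluated through a point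
  where the minimum is attained.\<close>

lemma moreau_envelope_eqI:
  assumes "\<And>v. moreau_objective \<theta> f g x u \<le> moreau_objective \<theta> f g x v"
  shows "moreau_envelope \<theta> f g x = moreau_objective \<theta> f g x u"
  unfolding moreau_envelope_def using assms by (intro Least_equality) auto

text \<open>The weight \<open>c\<close> below is \<open>1 / sqrt \<theta>\<close>, and \<open>P x\<close> is a minimiser for \<open>x\<close>.\<close>

lemma is_norm_plane_infimal_convolution:
  assumes N: "is_norm N" and N': "is_norm N'" and c: "0 < c"
    and R: "\<And>x. R x = sqrt ((N (P x))\<^sup>2 + (c * N' (x - P x))\<^sup>2)"
    and least: "\<And>x u. R x \<le> sqrt ((N u)\<^sup>2 + (c * N' (x - u))\<^sup>2)"
  shows "is_norm R"
  unfolding is_norm_def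
proof (intro conjI allI)
  note n = is_normD[OF N] and n' = is_normD[OF N']
  show nonneg: "0 \<le> R x" for x by (simp add: R)
  show "R x = 0 \<longleftrightarrow> x = 0" for x
  proof
    assume "R x = 0"
    then have "N (P x) = 0" "c * N' (x - P x) = 0"
      by (simp_all add: R sum_power2_eq_zero_iff)
    then show "x = 0" using c n(2)[of "P x"] n'(2)[of "x - P x"] by simp
  next
    assume "x = 0"
    then show "R x = 0" using least[of x 0] nonneg[of x] n(2)[of 0] n'(2)[of 0] by simp
  qed
  \<comment> \<open>Scaling the minimiser of \<open>x\<close> gives a trial point for
    \<open>a *\<^sub>R x\<close>, hence one inequality; for nonzero \<open>a\<close> the reverse one
    is the same fact for \<open>inverse a\<close> at \<open>a *\<^sub>R x\<close>.\<close>
  have le: "R (a *\<^sub>R x) \<le> \<bar>a\<bar> * R x" for a x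
  proof -
    have "R (a *\<^sub>R x) \<le> sqrt ((N (a *\<^sub>R P x))\<^sup>2 + (c * N' (a *\<^sub>R x - a *\<^sub>R P x))\<^sup>2)"
      by (rule least)
    also have "\<dots> = sqrt (a\<^sup>2 * ((N (P x))\<^sup>2 + (c * N' (x - P x))\<^sup>2))"
      by (simp only: scaleR_diff_right[symmetric] n(3) n'(3))
        (simp add: power_mult_distrib algebra_simps)
    also have "\<dots> = \<bar>a\<bar> * R x" by (simp add: R real_sqrt_mult)
    finally show ?thesis .
  qed
  show "R (a *\<^sub>R x) = \<bar>a\<bar> * R x" for a x
  proof (cases "a = 0")
    case True
    then show ?thesis using le[of 0 x] nonneg[of 0] by simp
  next
    case False
    then have "\<bar>a\<bar> * R x \<le> R (a *\<^sub>R x)"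
      using le[of "inverse a" "a *\<^sub>R x"] by (simp add: abs_inverse field_simps)
    with le[of a x] show ?thesis by simp
  qed
  show "R (x + y) \<le> R x + R y" for x y
  proof -
    \<comment> \<open>The sum of the two minimisers serves as trial point for
      \<open>x + y\<close>.\<close>
    have "R (x + y) \<le> sqrt ((N (P x + P y))\<^sup>2 + (c * N' ((x - P x) + (y - P y)))\<^sup>2)"
      using least[of "x + y" "P x + P y"] by (simp add: algebra_simps)
    also have "\<dots> \<le> sqrt ((N (P x) + N (P y))\<^sup>2 + (c * N' (x - P x) + c * N' (y - P y))\<^sup>2)"
      using c n(4)[of "P x" "P y"] n'(4)[of "x - P x" "y - P y"]
      by (intro real_sqrt_le_mono add_mono power_mono)
        (auto simp: n(1) n'(1) distrib_left[symmetric])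
    also have "\<dots> \<le> R x + R y"
      unfolding R by (rule real_sqrt_sum_squares_triangle_ineq)
    finally show ?thesis .
  qed
qed

lemma sqrt_mult_le_of_square_le:
  assumes "0 \<le> a" "0 \<le> b" "0 \<le> t" "t * a\<^sup>2 \<le> b\<^sup>2"
  shows "sqrt t * a \<le> b"
  by (rule power2_le_imp_le) (use assms in \<open>simp_all add: power_mult_distrib\<close>)

theorem proposition2p1:
  fixes norm_c norm_s f g M :: "real ^ 'd \<Rightarrow> real" and L \<theta> :: real
  assumes "is_norm norm_c"
    and "is_norm norm_s"
    and f: "f = (\<lambda>x. 1 / 2 * (norm_c x)\<^sup>2)"
    and g: "g = (\<lambda>x. 1 / 2 * (norm_s x)\<^sup>2)"
    and "L > 0"
    and "smooth_wrt L norm_s g"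
    and "\<theta> > 0"
    and M: "M = moreau_envelope \<theta> f g"
  shows "(\<forall>x. \<exists>u. is_arg_min (moreau_objective \<theta> f g x) (\<lambda>_. True) u) \<and>
    (\<exists>norm_m. is_norm norm_m \<and> (\<forall>x. M x = 1 / 2 * (norm_m x)\<^sup>2) \<and>
       (\<forall>l_cs u_cs. 0 < l_cs \<and> l_cs \<le> 1 \<and> 1 \<le> u_cs \<and>
          (\<forall>x. l_cs * norm_s x \<le> norm_c x \<and> norm_c x \<le> u_cs * norm_s x) \<longrightarrow>
          (\<forall>x. sqrt (1 + \<theta> * l_cs\<^sup>2) * norm_m x \<le> norm_c x \<and>
               norm_c x \<le> sqrt (1 + \<theta> * u_cs\<^sup>2) * norm_m x))) \<and>
    convex_on UNIV M \<and>
    smooth_wrt (L / \<theta>) norm_s M"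
proof -
  note nc = is_normD[OF \<open>is_norm norm_c\<close>] and ns = is_normD[OF \<open>is_norm norm_s\<close>]
  let ?J = "moreau_objective \<theta> f g"
  have J: "?J x u = 1 / 2 * ((norm_c u)\<^sup>2 + (norm_s (x - u))\<^sup>2 / \<theta>)" for x u
    by (simp add: moreau_objective_def f g algebra_simps)
  have "\<exists>u. \<forall>v. ?J x u \<le> ?J x v" for x
    unfolding f g by (rule moreau_objective_attains_min) fact+
  then obtain P where P: "\<And>x v. ?J x (P x) \<le> ?J x v" by metis
  have MP: "M x = ?J x (P x)" for x
    unfolding M by (rule moreau_envelope_eqI) (rule P)
  have M_le: "M x \<le> ?J x u" for x u using P[of x u] by (simp add: MP)
  \<comment> \<open>Doubling cancels the \<open>1 / 2\<close> in \<open>f\<close> and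
    \<open>g\<close>, so \<open>R x\<close> is the length of a plane vector. This is the witness for
    \<open>norm_m\<close>.\<close>
  define R where "R x = sqrt (2 * M x)" for x
  have twoJ: "2 * ?J x u = (norm_c u)\<^sup>2 + (1 / sqrt \<theta> * norm_s (x - u))\<^sup>2" for x u
    using \<open>\<theta> > 0\<close> by (simp add: J power_mult_distrib power_divide)
  have R: "is_norm R"
  proof (rule is_norm_plane_infimal_convolution)
    show "R x = sqrt ((norm_c (P x))\<^sup>2 + (1 / sqrt \<theta> * norm_s (x - P x))\<^sup>2)" for x
      by (simp only: R_def MP twoJ)
    show "R x \<le> sqrt ((norm_c u)\<^sup>2 + (1 / sqrt \<theta> * norm_s (x - u))\<^sup>2)" for x u
      unfolding R_def twoJ[symmetric] using M_le[of x u] by simp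
  qed (use assms in simp_all)
  have "0 \<le> M x" for x using \<open>\<theta> > 0\<close> by (simp add: MP J)
  then have R2: "(R x)\<^sup>2 = 2 * M x" for x by (simp add: R_def)
  then have MR: "M x = 1 / 2 * (R x)\<^sup>2" for x by simp
  have "M = (\<lambda>x. 1 / 2 * (R x)\<^sup>2)" using MR by blast
  then have M_convex: "convex_on UNIV M" using is_norm_half_square_convex_on[OF R] by simp
  have bounds: "sqrt (1 + \<theta> * l\<^sup>2) * R x \<le> norm_c x \<and> norm_c x \<le> sqrt (1 + \<theta> * w\<^sup>2) * R x"
    if l: "0 < l" and lw: "\<And>x. l * norm_s x \<le> norm_c x \<and> norm_c x \<le> w * norm_s x"
    for l w x
  proof
    define D where "D = 1 + \<theta> * l\<^sup>2"
    have D: "0 < D" using \<open>\<theta> > 0\<close> by (simp add: D_def add_pos_nonneg)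
    text \<open>The test point \<open>x /\<^sub>R D\<close> minimises the bound obtained from \<open>norm_s \<le> norm_c / l\<close> over the
      multiples of \<open>x\<close>.\<close>
    have diff: "x - x /\<^sub>R D = (\<theta> * l\<^sup>2 / D) *\<^sub>R x"
    proof -
      have "x - x /\<^sub>R D = (1 - inverse D) *\<^sub>R x" by (simp add: algebra_simps)
      also have "1 - inverse D = \<theta> * l\<^sup>2 / D" using D by (simp add: field_simps) (simp add: D_def)
      finally show ?thesis .
    qed
    have "(l * norm_s x)\<^sup>2 \<le> (norm_c x)\<^sup>2"
      using lw[of x] l by (intro power_mono) (auto simp: ns(1))
    have "2 * M x \<le> 2 * ?J x (x /\<^sub>R D)" using M_le by simp
    \<comment> \<open>Of the four factors \<open>l\<close> in the second term, two are kept with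
      \<open>norm_s x\<close> to be absorbed into \<open>norm_c x\<close>; the coefficients then add
      up to \<open>D / D\<^sup>2\<close>.\<close>
    also have "\<dots> = (norm_c x)\<^sup>2 / D\<^sup>2 + \<theta> * l\<^sup>2 * (l * norm_s x)\<^sup>2 / D\<^sup>2"
      using D \<open>\<theta> > 0\<close> unfolding J diff nc(3) ns(3)
      by (simp add: power_mult_distrib power_divide abs_mult field_simps power2_eq_square)
    also have "\<dots> \<le> (norm_c x)\<^sup>2 / D\<^sup>2 + \<theta> * l\<^sup>2 * (norm_c x)\<^sup>2 / D\<^sup>2"
      using \<open>(l * norm_s x)\<^sup>2 \<le> (norm_c x)\<^sup>2\<close> \<open>\<theta> > 0\<close>
      by (intro add_left_mono divide_right_mono mult_left_mono) auto
    also have "\<dots> = D * (norm_c x)\<^sup>2 / D\<^sup>2"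
      by (simp add: D_def add_divide_distrib distrib_right)
    also have "\<dots> = (norm_c x)\<^sup>2 / D" using D by (simp add: power2_eq_square)
    finally have "D * (R x)\<^sup>2 \<le> (norm_c x)\<^sup>2" using D by (simp add: R2 field_simps)
    then show "sqrt (1 + \<theta> * l\<^sup>2) * R x \<le> norm_c x"
      unfolding D_def[symmetric]
      using D by (intro sqrt_mult_le_of_square_le) (auto simp: is_normD(1)[OF R] nc(1))
  next
    define p q where "p = norm_c (P x)" and "q = norm_s (x - P x)"
    have pq: "norm_c x \<le> p + w * q"
      using nc(4)[of "P x" "x - P x"] lw[of "x - P x"] by (simp add: p_def q_def)
    then have "(norm_c x)\<^sup>2 \<le> (p + w * q)\<^sup>2" by (intro power_mono) (auto simp: nc(1))
    \<comment> \<open>Lagrange's identity for the vectors \<open>(1, sqrt \<theta> * w)\<close> and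
      \<open>(p, q / sqrt \<theta>)\<close>; the subtracted square is the Cauchy-Schwarz
      defect.\<close>
    also have "\<dots> = (1 + \<theta> * w\<^sup>2) * (p\<^sup>2 + q\<^sup>2 / \<theta>) - (\<theta> * w * p - q)\<^sup>2 / \<theta>"
      using \<open>\<theta> > 0\<close> by (simp add: field_simps power2_eq_square)
    also have "\<dots> \<le> (1 + \<theta> * w\<^sup>2) * (p\<^sup>2 + q\<^sup>2 / \<theta>)" using \<open>\<theta> > 0\<close> by simp
    also have "\<dots> = (1 + \<theta> * w\<^sup>2) * (R x)\<^sup>2" by (simp add: R2 MP J p_def q_def)
    also have "\<dots> = (sqrt (1 + \<theta> * w\<^sup>2) * R x)\<^sup>2"
      using \<open>\<theta> > 0\<close> by (simp add: power_mult_distrib)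
    finally show "norm_c x \<le> sqrt (1 + \<theta> * w\<^sup>2) * R x"
      by (rule power2_le_imp_le) (use \<open>\<theta> > 0\<close> in \<open>auto simp: is_normD(1)[OF R]\<close>)
  qed
  obtain G where G: "\<And>x y. g y \<le> g x + G x \<bullet> (y - x) + L / 2 * (norm_s (x - y))\<^sup>2"
    using \<open>smooth_wrt L norm_s g\<close> unfolding smooth_wrt_def by blast
  have "smooth_wrt (L / \<theta>) norm_s M"
  proof (rule convex_smooth_wrtI[OF M_convex \<open>is_norm norm_s\<close>])
    show "0 \<le> L / \<theta>" using \<open>L > 0\<close> \<open>\<theta> > 0\<close> by simp
    fix x y
    have "M y \<le> f (P x) + 1 / \<theta> * g (y - P x)"
      using M_le[of y "P x"] by (simp add: moreau_objective_def)
    \<comment> \<open>The arguments \<open>y - P x\<close> and \<open>x - P x\<close> differ by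
      \<open>y - x\<close>, so the bound for \<open>g\<close> between them has the increment needed
      for \<open>M\<close>.\<close>
    also have "\<dots> \<le> f (P x) + 1 / \<theta> * (g (x - P x) + G (x - P x) \<bullet> (y - x) + L / 2 * (norm_s (x - y))\<^sup>2)"
      using G[of "y - P x" "x - P x"] \<open>\<theta> > 0\<close> by (intro add_left_mono mult_left_mono) auto
    also have "\<dots> = M x + ((1 / \<theta>) *\<^sub>R G (x - P x)) \<bullet> (y - x) + L / \<theta> / 2 * (norm_s (x - y))\<^sup>2"
      by (simp add: MP moreau_objective_def algebra_simps add_divide_distrib)
    finally show "M y \<le> M x + ((1 / \<theta>) *\<^sub>R G (x - P x)) \<bullet> (y - x) + L / \<theta> / 2 * (norm_s (x - y))\<^sup>2" .
  qed
  \<comment> \<open>Attainment makes the \<open>LEAST\<close> value in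
    \<open>moreau_envelope\<close> a genuine minimum.\<close>
  moreover have "\<forall>x. \<exists>u. is_arg_min (?J x) (\<lambda>_. True) u"
    using P by (auto simp: is_arg_min_linorder)
  ultimately show ?thesis using R MR bounds M_convex by blast
qed

end
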